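(* Let $D$ be a positive nonsquare integer and suppose the equation $x^2-Dy^2=-1$ has positive integer solutions; let $\varepsilon=x_1+y_1\sqrt{D}$ be its fundamental solution. Let $(x,y)$ be a positive integer solution of $x^2-Dy^2=-1$ with $y=p^n y'$, where $p$ is a prime not dividing $D$, $n$ is a positive integer and $y'$ is a positive integer. If every prime divisor of $y'$ divides $D$, then $x+y\sqrt{D}=\varepsilon$ or $x+y\sqrt{D}=\varepsilon^q$ for some odd prime $q$ with $\gcd(p,q)=1$.
   Context: The fundamental solution of $x^2-Dy^2=-1$ is the positive integer solution $(x_1,y_1)$ for which $x_1+y_1\sqrt{D}$ is smallest. *)

theory Defs
  imports Complex_Main "HOL-Computational_Algebra.Nth_Powers"
begin

definition neg_pell_solution :: "int \<Rightarrow> int \<times> int \<Rightarrow> bool" where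
  "neg_pell_solution D = (\<lambda>(x, y). x > 0 \<and> y > 0 \<and> x\<^sup>2 - D * y\<^sup>2 = -1)"

definition pell_real :: "int \<Rightarrow> int \<times> int \<Rightarrow> real" where
  "pell_real D = (\<lambda>(x, y). of_int x + of_int y * sqrt (of_int D))"

definition neg_pell_fundamental :: "int \<Rightarrow> int \<times> int \<Rightarrow> bool" where
  "neg_pell_fundamental D = is_arg_min (pell_real D) (neg_pell_solution D)"

end

theory Submission
  imports Defs
begin

text \<open>
  Every solution is an odd power of the fundamental solution \<open>\<epsilon>\<close>. If
  \<open>(x + y \<surd>D)\<^sup>q = X + Y \<surd>D\<close> for an odd prime \<open>q\<close>, then \<open>S = Y / y\<close> is congruent to
  \<open>q x\<^sup>q\<^sup>-\<^sup>1\<close> modulo \<open>t = D y\<^sup>2\<close>, and modulo \<open>q\<^sup>2\<close> if \<open>q\<close> divides \<open>t\<close>. As \<open>x\<close> and \<open>t\<close> are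
  coprime and \<open>S > q\<close>, some prime dividing \<open>Y\<close> divides neither \<open>D\<close> nor \<open>y\<close>. If
  \<open>x + y \<surd>D = \<epsilon>\<^sup>k\<close> with \<open>k\<close> not prime and \<open>k > 1\<close>, two such steps on a divisor chain of \<open>k\<close>
  produce two distinct primes dividing \<open>y\<close> but not \<open>D\<close>, whereas \<open>p\<close> is the only one. Finally
  \<open>p = q\<close> is excluded because \<open>S\<close> is congruent to a power of \<open>t\<close> modulo \<open>q\<close>.
\<close>

section \<open>Integer coefficients of powers of a binomial\<close>

text \<open>For \<open>w\<^sup>2 = t\<close> these are the coefficients of \<open>1\<close>
  (\<open>b = False\<close>) and of \<open>w\<close> (\<open>b = True\<close>) in
  \<open>(x + w) ^ k\<close>, kept as integers so that divisibility makes sense.\<close>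

definition binomial_part :: "bool \<Rightarrow> int \<Rightarrow> int \<Rightarrow> nat \<Rightarrow> int" where
  "binomial_part b x t k =
     (\<Sum>i\<le>k. if odd i = b then of_nat (k choose i) * t ^ (i div 2) * x ^ (k - i) else 0)"

lemma binomial_parts_power:
  fixes w :: real
  assumes "w\<^sup>2 = of_int t"
  shows "(of_int x + w) ^ k = of_int (binomial_part False x t k) + of_int (binomial_part True x t k) * w"
proof -
  have w: "w ^ i = of_int (t ^ (i div 2)) * (if odd i then w else 1)" for i
  proof -
    have "w ^ i = w ^ (2 * (i div 2) + i mod 2)" by simp
    also have "\<dots> = (w\<^sup>2) ^ (i div 2) * w ^ (i mod 2)" by (simp only: power_add power_mult)
    also have "w ^ (i mod 2) = (if odd i then w else 1)" by (simp add: odd_iff_mod_2_eq_one even_iff_mod_2_eq_zero)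
    finally show ?thesis by (simp add: assms)
  qed
  have "(of_int x + w) ^ k = (w + of_int x) ^ k" by (simp add: add.commute)
  also have "\<dots> = (\<Sum>i\<le>k. of_nat (k choose i) * w ^ i * of_int x ^ (k - i))"
    by (rule binomial_ring)
  also have "\<dots> = (\<Sum>i\<le>k. of_int (if odd i = False then of_nat (k choose i) * t ^ (i div 2) * x ^ (k - i) else 0)
      + of_int (if odd i = True then of_nat (k choose i) * t ^ (i div 2) * x ^ (k - i) else 0) * w)"
    by (rule sum.cong) (auto simp: w)
  finally show ?thesis
    by (simp only: binomial_part_def of_int_sum sum.distrib sum_distrib_right)
qed

text \<open>Both \<open>w\<close> and \<open>- w\<close> are square roots of \<open>t\<close>;
  multiplying the two expansions gives the norm.\<close>

lemma binomial_part_norm: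
  assumes "t \<ge> 0"
  shows "(binomial_part False x t k)\<^sup>2 - t * (binomial_part True x t k)\<^sup>2 = (x\<^sup>2 - t) ^ k"
    (is "?a\<^sup>2 - t * ?s\<^sup>2 = _")
proof -
  define w where "w = sqrt (of_int t)"
  have w: "w\<^sup>2 = of_int t" using assms by (simp add: w_def)
  have "of_int (?a\<^sup>2 - t * ?s\<^sup>2) = (of_int ?a + of_int ?s * w) * (of_int ?a + of_int ?s * (- w))"
    by (simp add: algebra_simps power2_eq_square flip: w)
  also have "\<dots> = ((of_int x + w) * (of_int x + - w)) ^ k"
    using w by (simp only: power_mult_distrib binomial_parts_power power2_minus)
  also have "(of_int x + w) * (of_int x + - w) = of_int (x\<^sup>2 - t)"
    by (simp add: algebra_simps power2_eq_square flip: w)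
  finally show ?thesis by (simp only: of_int_eq_iff flip: of_int_power)
qed

text \<open>Isolates the terms \<open>i = 1\<close> and \<open>i = k\<close>: the first is what
  remains modulo \<open>t\<close>, the second what remains modulo a prime \<open>k\<close>.\<close>

lemma binomial_part_odd_split:
  assumes "odd k" "k > 1"
  shows "binomial_part True x t k = of_nat k * x ^ (k - 1) + t ^ (k div 2)
    + (\<Sum>i\<in>{2..<k}. if odd i then of_nat (k choose i) * t ^ (i div 2) * x ^ (k - i) else 0)"
proof -
  have "{..k} = insert 0 (insert 1 (insert k {2..<k}))" using assms by auto
  then show ?thesis using assms by (simp add: binomial_part_def)
qed

lemma binomial_part_odd_gt:
  assumes "odd k" "k > 1" "x > 0" "t > 0"
  shows "binomial_part True x t k > int k"
proof -
  have "(\<Sum>i\<in>{2..<k}. if odd i then of_nat (k choose i) * t ^ (i div 2) * x ^ (k - i) else 0) \<ge> 0"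
    using assms by (intro sum_nonneg) auto
  moreover have "x ^ (k - 1) \<ge> 1" using assms by simp
  then have "int k * x ^ (k - 1) \<ge> int k * 1" using assms by (intro mult_left_mono) auto
  moreover have "t ^ (k div 2) > 0" using assms by simp
  ultimately show ?thesis unfolding binomial_part_odd_split[OF assms(1,2)] by linarith
qed

lemma binomial_part_odd_mod_base:
  assumes "odd k" "k > 1"
  shows "t dvd binomial_part True x t k - of_nat k * x ^ (k - 1)"
proof -
  have "t dvd t ^ (i div 2)" if "i \<ge> 2" for i :: nat
    using that by (intro dvd_power) auto
  then show ?thesis using assms
    by (auto simp: binomial_part_odd_split intro!: dvd_add dvd_sum)
qed

lemma binomial_part_odd_mod_prime:
  assumes "odd q" "prime q"
  shows "int q dvd binomial_part True x t q - t ^ (q div 2)"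
proof -
  have "q > 1" using assms prime_gt_1_nat by blast
  moreover have "int q dvd int (q choose i)" if "i \<in> {2..<q}" for i
    using that assms by (auto intro!: dvd_choose_prime)
  ultimately show ?thesis using assms
    by (auto simp: binomial_part_odd_split intro!: dvd_add dvd_sum)
qed

text \<open>A middle term gets one factor \<open>q\<close> from the binomial coefficient and one
  from \<open>t\<close>; the last term needs \<open>q div 2 \<ge> 2\<close>, hence
  \<open>q > 3\<close>.\<close>

lemma binomial_part_odd_mod_prime_square:
  assumes "odd q" "prime q" "q > 3" "int q dvd t"
  shows "(int q)\<^sup>2 dvd binomial_part True x t q - of_nat q * x ^ (q - 1)"
proof -
  have "(int q)\<^sup>2 dvd t ^ (q div 2)"
  proof -
    have "(int q)\<^sup>2 dvd t\<^sup>2" using assms by simp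
    also have "t\<^sup>2 dvd t ^ (q div 2)" using assms(1,3) by (intro le_imp_power_dvd) (auto elim!: oddE)
    finally show ?thesis .
  qed
  moreover have "(int q)\<^sup>2 dvd int (q choose i) * t ^ (i div 2)" if "i \<in> {2..<q}" for i
  proof -
    have "int q dvd int (q choose i)" using that assms by (auto intro!: dvd_choose_prime)
    moreover have "int q dvd t ^ (i div 2)" using that assms by (intro dvd_trans[OF _ dvd_power]) auto
    ultimately show ?thesis by (simp add: power2_eq_square mult_dvd_mono)
  qed
  ultimately show ?thesis using assms
    by (auto simp: binomial_part_odd_split intro!: dvd_add dvd_sum)
qed

text \<open>If every prime divisor of \<open>S\<close> divided \<open>t\<close>, the congruence
  modulo \<open>t\<close> would leave only \<open>q\<close>; then \<open>S > q\<close> forces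
  \<open>q\<^sup>2\<close> to divide \<open>S\<close>, against the congruence modulo
  \<open>q\<^sup>2\<close>.\<close>

lemma binomial_part_primitive_prime:
  assumes "x > 0" "t > 0" "x\<^sup>2 - t = -1" "prime q" "odd q"
  shows "\<exists>r. prime r \<and> r dvd binomial_part True x t q \<and> \<not> r dvd t"
proof (rule ccontr)
  define S where "S = binomial_part True x t q"
  assume "\<not> ?thesis"
  then have all: "r dvd t" if "prime r" "r dvd S" for r
    using that S_def by blast
  have q: "q > 1" using assms prime_gt_1_nat by blast
  have cop: "\<not> r dvd x" if "prime r" "r dvd t" for r
  proof
    assume "r dvd x"
    then have "r dvd t - x\<^sup>2" using that by (simp add: power2_eq_square)
    also have "t - x\<^sup>2 = 1" using assms by simp
    finally show False using that by (simp add: not_prime_unit)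
  qed
  have is_q: "r = int q" if r: "prime r" "r dvd S" for r
  proof -
    have "t dvd S - int q * x ^ (q - 1)"
      using binomial_part_odd_mod_base[of q t x] assms q S_def by simp
    then have "r dvd S - int q * x ^ (q - 1)" using all[OF r] dvd_trans by blast
    then have "r dvd int q * x ^ (q - 1)"
      using r(2) by (metis dvd_diff_commute dvd_diff_right_iff)
    then have "r dvd int q"
      using r cop[OF r(1) all[OF r]] by (auto simp: prime_dvd_mult_iff dest: prime_dvd_power)
    then show ?thesis using r assms by (simp add: primes_dvd_imp_eq)
  qed
  have gt: "S > int q"
    using binomial_part_odd_gt[of q x t] assms q S_def by simp
  obtain r where "prime r" "r dvd S"
    using gt q prime_divisor_exists[of S] by auto
  then have qS: "int q dvd S" using is_q by blast
  then obtain S' where S': "S = int q * S'" ..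
  \<comment> \<open>The cofactor exceeds 1, so it has a prime divisor, which again can only be
    \<open>q\<close>.\<close>
  have "int q * 1 < int q * S'" using gt S' by simp
  then have "S' > 1" using q by (subst (asm) mult_less_cancel_left_pos) auto
  then obtain r' where "prime r'" "r' dvd S'"
    using prime_divisor_exists[of S'] by auto
  then have "int q dvd S'" using is_q[of r'] S' by auto
  then have sq: "(int q)\<^sup>2 dvd S" using S' by (simp add: power2_eq_square)
  have qt: "int q dvd t" using all qS assms by simp
  \<comment> \<open>\<open>-1\<close> is not a square modulo 3; for \<open>q = 3\<close> the term \<open>t ^ (q div 2)\<close> is only divisible by \<open>q\<close>.\<close>
  have "q \<noteq> 3"
  proof
    assume "q = 3"
    then have "t mod 3 = 0" using qt by auto
    then have "x\<^sup>2 mod 3 = 2" using assms by presburger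
    moreover have "x mod 3 \<in> {0, 1, 2}" by auto
    then have "(x mod 3)\<^sup>2 mod 3 \<noteq> 2" by auto
    ultimately show False by (simp add: power_mod)
  qed
  then have "q > 3" using assms q by (cases "q = 2") auto
  then have "(int q)\<^sup>2 dvd S - int q * x ^ (q - 1)"
    using binomial_part_odd_mod_prime_square[of q t x] assms qt S_def by simp
  then have "(int q)\<^sup>2 dvd int q * x ^ (q - 1)"
    using sq by (metis dvd_diff_commute dvd_diff_right_iff)
  then have "int q dvd x ^ (q - 1)" using q by (simp add: power2_eq_square)
  moreover have pq: "prime (int q)" using assms(4) by simp
  ultimately have "int q dvd x" using prime_dvd_power by blast
  then show False using cop[OF pq qt] by blast
qed

section \<open>Solutions of the negative Pell equation\<close>

lemma neg_pell_conjugate: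
  assumes "D > 0" "u\<^sup>2 - D * v\<^sup>2 = -1"
  shows "(of_int u - of_int v * sqrt (of_int D)) * pell_real D (u, v) = -1"
proof -
  have "(of_int u - of_int v * sqrt (of_int D)) * pell_real D (u, v)
      = (of_int u)\<^sup>2 - (sqrt (of_int D))\<^sup>2 * (of_int v)\<^sup>2"
    by (simp add: pell_real_def algebra_simps power2_eq_square)
  also have "\<dots> = of_int (u\<^sup>2 - D * v\<^sup>2)" using assms(1) by simp
  finally show ?thesis by (simp only: assms(2) of_int_minus of_int_1)
qed

text \<open>The conjugate of \<open>z\<close> is \<open>- 1 / z\<close>, so sum and difference with
  \<open>z\<close> recover the coordinates. Signs, order and uniqueness of solutions can thus be
  read off the real value.\<close>

lemma neg_pell_components:
  assumes "D > 0" "u\<^sup>2 - D * v\<^sup>2 = -1" "pell_real D (u, v) = z"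
  shows "z \<noteq> 0" "2 * of_int u = z - 1 / z" "2 * of_int v * sqrt (of_int D) = z + 1 / z"
proof -
  have *: "(of_int u - of_int v * sqrt (of_int D)) * z = -1"
    using neg_pell_conjugate assms by blast
  then show z: "z \<noteq> 0" by auto
  have "of_int u - of_int v * sqrt (of_int D) = - 1 / z"
    using * z by (simp add: field_simps)
  moreover have "of_int u + of_int v * sqrt (of_int D) = z"
    using assms by (simp add: pell_real_def)
  ultimately show "2 * of_int u = z - 1 / z" "2 * of_int v * sqrt (of_int D) = z + 1 / z"
    by (auto simp: field_simps)
qed

lemma neg_pell_solution_of_gt_1:
  assumes "D > 0" "u\<^sup>2 - D * v\<^sup>2 = -1" "pell_real D (u, v) > 1"
  shows "neg_pell_solution D (u, v)"
proof -
  define z where "z = pell_real D (u, v)"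
  have z: "z > 1" "1 / z < 1" "1 / z > 0" using assms by (auto simp: z_def)
  note c = neg_pell_components[OF assms(1,2) z_def[symmetric]]
  have "real_of_int u > 0" using c(2) z by linarith
  moreover have "real_of_int v * sqrt (of_int D) > 0" using c(3) z by linarith
  then have "real_of_int v > 0" using assms by (simp add: zero_less_mult_iff)
  ultimately show ?thesis using assms by (simp add: neg_pell_solution_def)
qed

lemma neg_pell_solution_gt_1:
  assumes "D > 0" "neg_pell_solution D (u, v)"
  shows "pell_real D (u, v) > 1"
proof -
  have "real_of_int u \<ge> 1" "real_of_int v > 0" using assms by (auto simp: neg_pell_solution_def)
  moreover from this have "real_of_int v * sqrt (of_int D) > 0" using assms(1) by simp
  ultimately show ?thesis unfolding pell_real_def prod.case by linarith
qed

lemma neg_pell_solution_unique: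
  assumes "D > 0" "neg_pell_solution D (u, v)" "neg_pell_solution D (u', v')"
    and eq: "pell_real D (u, v) = pell_real D (u', v')"
  shows "u = u' \<and> v = v'"
proof -
  have "u\<^sup>2 - D * v\<^sup>2 = -1" "u'\<^sup>2 - D * v'\<^sup>2 = -1"
    using assms by (auto simp: neg_pell_solution_def)
  note c = neg_pell_components[OF assms(1) this(1) eq] neg_pell_components[OF assms(1) this(2) refl]
  have "real_of_int u = of_int u'" using c by simp
  moreover have "real_of_int v * sqrt (of_int D) = of_int v' * sqrt (of_int D)" using c by linarith
  ultimately show ?thesis using assms by simp
qed

text \<open>The norm is multiplicative, and an odd power of -1 is -1.\<close>

lemma neg_pell_odd_power:
  assumes "D > 0" "neg_pell_solution D (x, y)" "odd k"
  defines "X \<equiv> binomial_part False x (D * y\<^sup>2) k"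
    and "Y \<equiv> y * binomial_part True x (D * y\<^sup>2) k"
  shows "neg_pell_solution D (X, Y)" "pell_real D (X, Y) = pell_real D (x, y) ^ k"
proof -
  have xy: "x > 0" "y > 0" "x\<^sup>2 - D * y\<^sup>2 = -1" using assms by (auto simp: neg_pell_solution_def)
  have "(of_int y * sqrt (of_int D))\<^sup>2 = (of_int (D * y\<^sup>2) :: real)"
    using assms(1) by (simp add: power_mult_distrib)
  from binomial_parts_power[OF this, of x k]
  show pow: "pell_real D (X, Y) = pell_real D (x, y) ^ k"
    by (simp add: pell_real_def X_def Y_def mult_ac)
  have "X\<^sup>2 - D * Y\<^sup>2 = -1"
    using binomial_part_norm[of "D * y\<^sup>2" x k] assms(1,3) xy
    by (simp add: X_def Y_def power_mult_distrib algebra_simps)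
  moreover have "pell_real D (X, Y) > 1"
    unfolding pow using neg_pell_solution_gt_1[OF assms(1,2)] assms(3) by (intro one_less_power) (auto elim: oddE)
  ultimately show "neg_pell_solution D (X, Y)"
    using neg_pell_solution_of_gt_1 assms by blast
qed

lemma neg_pell_primitive_prime:
  assumes "D > 0" "neg_pell_solution D (x, y)" "neg_pell_solution D (X, Y)"
    and "prime q" "odd q" "pell_real D (X, Y) = pell_real D (x, y) ^ q"
  shows "y dvd Y" "\<exists>r. prime r \<and> r dvd Y \<and> \<not> r dvd D \<and> \<not> r dvd y"
    and "int q dvd Y \<Longrightarrow> int q dvd D \<or> int q dvd y"
proof -
  define S where "S = binomial_part True x (D * y\<^sup>2) q"
  have xy: "x > 0" "y > 0" "x\<^sup>2 - D * y\<^sup>2 = -1" using assms by (auto simp: neg_pell_solution_def)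
  have Y: "Y = y * S"
    using neg_pell_odd_power[OF assms(1,2,5)] neg_pell_solution_unique assms unfolding S_def by metis
  then show "y dvd Y" by simp
  obtain r where "prime r" "r dvd S" "\<not> r dvd D * y\<^sup>2"
    using binomial_part_primitive_prime[OF xy(1) _ xy(3) assms(4,5)] xy assms(1) unfolding S_def by auto
  then show "\<exists>r. prime r \<and> r dvd Y \<and> \<not> r dvd D \<and> \<not> r dvd y"
    using Y by (intro exI[of _ r]) (auto simp: power2_eq_square)
  assume "int q dvd Y"
  then consider "int q dvd y" | "int q dvd S" using Y assms(4) by (auto simp: prime_dvd_mult_iff)
  then show "int q dvd D \<or> int q dvd y"
  proof cases
    \<comment> \<open>Modulo \<open>q\<close> the cofactor \<open>S\<close> is a power of
      \<open>D * y\<^sup>2\<close>, so \<open>q\<close> divides that base.\<close>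
    case 2
    with binomial_part_odd_mod_prime[OF assms(5,4), of x "D * y\<^sup>2"]
    have "int q dvd (D * y\<^sup>2) ^ (q div 2)"
      unfolding S_def by (metis dvd_diff_commute dvd_diff_right_iff)
    then have "int q dvd D * y\<^sup>2" using assms(4) prime_dvd_power[of "int q" "D * y\<^sup>2" "q div 2"] by simp
    then show ?thesis using assms(4) by (simp add: prime_dvd_mult_iff prime_dvd_power_iff)
  qed auto
qed

text \<open>Descent: dividing by the square of the fundamental value keeps the norm -1 and lowers
  \<open>x\<close>, until the fundamental solution itself is reached.\<close>

lemma neg_pell_solution_is_power:
  assumes "D > 0" "neg_pell_fundamental D (a, b)" "neg_pell_solution D (x, y)" and D1: "D \<noteq> 1"
  shows "\<exists>k. odd k \<and> pell_real D (x, y) = pell_real D (a, b) ^ k"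
  using assms(3)
proof (induction "nat x" arbitrary: x y rule: less_induct)
  case less
  define e where "e = pell_real D (a, b)"
  define E where "E = pell_real D (x, y)"
  have sol: "neg_pell_solution D (a, b)"
    and min: "e \<le> pell_real D (u, v)" if "neg_pell_solution D (u, v)" for u v
    using assms(2) that by (auto simp: neg_pell_fundamental_def is_arg_min_def e_def not_less)
  have ab: "a\<^sup>2 - D * b\<^sup>2 = -1" using sol[OF less.prems] by (simp add: neg_pell_solution_def)
  have xy: "x\<^sup>2 - D * y\<^sup>2 = -1" using less.prems by (simp add: neg_pell_solution_def)
  have e1: "e > 1" using neg_pell_solution_gt_1 assms(1) sol[OF less.prems] by (simp add: e_def)
  show ?case
  proof (cases "E = e")
    case True
    then show ?thesis by (intro exI[of _ 1]) (simp add: E_def e_def)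
  next
    case False
    then have Ee: "E > e" using min[OF less.prems] by (simp add: E_def)
    \<comment> \<open>These are the coordinates of \<open>x + y \<surd>D\<close> times the square of
      \<open>a - b \<surd>D\<close>, that is, of \<open>E / e\<^sup>2\<close>.\<close>
    define u where "u = x * (a\<^sup>2 + D * b\<^sup>2) - D * y * (2 * a * b)"
    define v where "v = y * (a\<^sup>2 + D * b\<^sup>2) - x * (2 * a * b)"
    have uv: "u\<^sup>2 - D * v\<^sup>2 = -1"
    proof -
      have "u\<^sup>2 - D * v\<^sup>2 = (x\<^sup>2 - D * y\<^sup>2) * (a\<^sup>2 - D * b\<^sup>2)\<^sup>2"
        unfolding u_def v_def by algebra
      then show ?thesis using ab xy by simp
    qed
    define F where "F = pell_real D (u, v)"
    have "F * e\<^sup>2 = E"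
    proof -
      define c where "c = of_int a - of_int b * sqrt (of_int D)"
      define s where "s = sqrt (of_int D)"
      have D: "s * s = of_int D" using assms(1) by (simp add: s_def)
      \<comment> \<open>Replacing \<open>D\<close> by \<open>s * s\<close> makes this a polynomial
        identity.\<close>
      have "F = E * c\<^sup>2"
        unfolding F_def E_def pell_real_def u_def v_def c_def prod.case s_def[symmetric]
          of_int_add of_int_mult of_int_diff of_int_power of_int_numeral
        unfolding D[symmetric] by algebra
      moreover have "c * e = -1"
        using neg_pell_conjugate[OF assms(1) ab] by (simp add: c_def e_def)
      then have "(c * e)\<^sup>2 = 1" by simp
      ultimately show ?thesis by (simp add: power_mult_distrib mult.assoc)
    qed
    then have F: "F = E / e\<^sup>2" using e1 by (auto simp: field_simps)
    have F_gt: "F > 1 / e" using Ee e1 by (simp add: F field_simps power2_eq_square)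
    then have "F > 0" using e1 by (smt (verit) divide_pos_pos)
    note c = neg_pell_components[OF assms(1) uv F_def[symmetric]]
    have "F \<noteq> 1"
    proof
      assume "F = 1"
      then have "D * v\<^sup>2 = 1" using c uv by simp
      then show False using assms(1) D1 by (auto simp: zmult_eq_1_iff)
    qed
    \<comment> \<open>Otherwise the negated conjugate \<open>1 / F\<close> would be the value of a
      solution strictly below \<open>e\<close>, against minimality.\<close>
    moreover have "\<not> F < 1"
    proof
      assume "F < 1"
      have *: "pell_real D (- u, v) = 1 / F"
        using c by (simp add: pell_real_def field_simps)
      then have "neg_pell_solution D (- u, v)"
        using \<open>F < 1\<close> \<open>F > 0\<close> uv assms(1) by (intro neg_pell_solution_of_gt_1) auto
      then have "e \<le> 1 / F" using min * by metis
      then show False using F_gt \<open>F > 0\<close> e1 by (simp add: field_simps)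
    qed
    ultimately have F1: "F > 1" by simp
    then have sol': "neg_pell_solution D (u, v)"
      using uv assms(1) F_def by (intro neg_pell_solution_of_gt_1) auto
    \<comment> \<open>As \<open>z - 1 / z\<close> increases with \<open>z\<close>, a smaller value
      gives a smaller first coordinate, so the induction hypothesis applies.\<close>
    have "F < E" using \<open>F * e\<^sup>2 = E\<close> F1 e1
      by (metis \<open>F > 0\<close> mult.right_neutral mult_less_cancel_left_pos one_less_power pos2)
    moreover have "1 / E < 1 / F" using \<open>F < E\<close> \<open>F > 0\<close> by (simp add: frac_less2)
    moreover have "2 * of_int x = E - 1 / E"
      using neg_pell_components[OF assms(1) xy E_def[symmetric]] by simp
    ultimately have "real_of_int u < of_int x" using c by linarith
    then have "nat u < nat x" using sol' by (simp add: neg_pell_solution_def)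
    from less.hyps[OF this sol'] obtain k where k: "odd k" "F = e ^ k"
      by (auto simp: F_def e_def)
    then have "E = e ^ (k + 2)" using \<open>F * e\<^sup>2 = E\<close> by (simp only: k(2) power_add)
    then show ?thesis using k by (intro exI[of _ "k + 2"]) (simp add: E_def e_def)
  qed
qed

section \<open>Prime divisors along a divisor chain of the exponent\<close>

theorem theorem3p7:
  fixes D x\<^sub>1 y\<^sub>1 x y y' p :: int and n :: nat
  assumes "D > 0" and "\<not> is_square D"
    and "neg_pell_fundamental D (x\<^sub>1, y\<^sub>1)"
    and "neg_pell_solution D (x, y)"
    and "y = p ^ n * y'"
    and "prime p" and "\<not> p dvd D"
    and "n > 0" and "y' > 0"
    and "\<forall>r. prime r \<and> r dvd y' \<longrightarrow> r dvd D"
  shows "pell_real D (x, y) = pell_real D (x\<^sub>1, y\<^sub>1) \<or>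
    (\<exists>q::nat. prime q \<and> odd q \<and> gcd p (int q) = 1 \<and>
       pell_real D (x, y) = pell_real D (x\<^sub>1, y\<^sub>1) ^ q)"
proof -
  have sol1: "neg_pell_solution D (x\<^sub>1, y\<^sub>1)"
    using assms(3) by (simp add: neg_pell_fundamental_def is_arg_min_def)
  have D1: "D \<noteq> 1" using assms(2) by auto
  have only_p: "r = p" if "prime r" "r dvd y" "\<not> r dvd D" for r
  proof -
    have "r dvd p"
      using that assms by (auto simp: prime_dvd_mult_iff dest: prime_dvd_power)
    then show ?thesis using that assms by (simp add: primes_dvd_imp_eq)
  qed
  have py: "p dvd y" using assms by (simp add: dvd_mult2)
  obtain k where k: "odd k" "pell_real D (x, y) = pell_real D (x\<^sub>1, y\<^sub>1) ^ k"
    using neg_pell_solution_is_power[OF assms(1,3,4) D1] by blast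
  show ?thesis
  proof (cases "k = 1")
    case True
    then show ?thesis using k by simp
  next
    case False
    then obtain q m where q: "prime q" "k = q * m"
      using prime_factor_nat[of k] by (auto elim: dvdE)
    then have odd: "odd q" "odd m" using k by auto
    obtain u v where uv: "neg_pell_solution D (u, v)" "pell_real D (u, v) = pell_real D (x\<^sub>1, y\<^sub>1) ^ m"
      using neg_pell_odd_power[OF assms(1) sol1 odd(2)] by blast
    have "pell_real D (x, y) = pell_real D (u, v) ^ q"
      using uv k q by (simp add: mult.commute flip: power_mult)
    note prim = neg_pell_primitive_prime[OF assms(1) uv(1) assms(4) q(1) odd(1) this]
    \<comment> \<open>The new prime in the step from \<open>v\<close> to \<open>y\<close> divides
      \<open>y\<close> but not \<open>D\<close>, so it is \<open>p\<close>; being new, it does not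
      divide \<open>v\<close>.\<close>
    have pv: "\<not> p dvd v" using prim(2) only_p by blast
    have "m = 1"
    proof (rule ccontr)
      assume "m \<noteq> 1"
      then obtain q' m' where q': "prime q'" "m = q' * m'"
        using prime_factor_nat[of m] by (auto elim: dvdE)
      then have odd': "odd q'" "odd m'" using odd by auto
      obtain u' v' where uv': "neg_pell_solution D (u', v')"
        "pell_real D (u', v') = pell_real D (x\<^sub>1, y\<^sub>1) ^ m'"
        using neg_pell_odd_power[OF assms(1) sol1 odd'(2)] by blast
      have "pell_real D (u, v) = pell_real D (u', v') ^ q'"
        using uv uv' q' by (simp add: mult.commute flip: power_mult)
      then obtain r where "prime r" "r dvd v" "\<not> r dvd D"
        using neg_pell_primitive_prime(2)[OF assms(1) uv'(1) uv(1) q'(1) odd'(1)] by blast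
      \<comment> \<open>As \<open>v\<close> divides \<open>y\<close>, this \<open>r\<close> would
        also have to be \<open>p\<close>, which does not divide \<open>v\<close>.\<close>
      then show False using only_p[of r] dvd_trans[OF _ prim(1)] pv by blast
    qed
    \<comment> \<open>If \<open>p\<close> were \<open>q\<close>, then \<open>q\<close> dividing
      \<open>y\<close> would force it to divide \<open>D\<close> or \<open>v\<close>, and
      \<open>p\<close> divides neither.\<close>
    moreover have "p \<noteq> int q" using prim(3) py pv assms(7) by auto
    then have "gcd p (int q) = 1"
      using assms(6) q(1) primes_coprime[of p "int q"] by (simp add: coprime_iff_gcd_eq_1)
    ultimately show ?thesis using q odd k by auto
  qed
qed

end
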